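(* Let $q$ be a prime power and $n$ a positive integer. (a) For every integer $m\geqslant 0$, the number of multispaces of rank $m$ over $\mathbb{F}_q^n$ is $$|\mathcal{M}_q(n,m)|=\sum_{k=0}^m\binom{n}{k}_{\!q}.$$ (b) For every $W\in\mathcal{M}_q(n)$ with $\operatorname{rank}(W)\geqslant 1$, the number of multispaces covered by $W$ in $(\mathcal{M}_q(n),\subseteq)$ is $$\begin{cases}\sum_{i=0}^{\dim(W)-1}q^i, & \operatorname{rank}(W)=\dim(W),\\ 1+\sum_{i=0}^{\dim(W)-1}q^i, & \operatorname{rank}(W)>\dim(W).\end{cases}$$ (c) For every $W\in\mathcal{M}_q(n)$, the number of multispaces that cover $W$ in $(\mathcal{M}_q(n),\subseteq)$ is $$1+\sum_{i=0}^{n-\dim(W)-1}q^i.$$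
   Context: A multiset $M$ over a universe $U$ is given by a multiplicity function $\mu_M\colon U\to\{0,1,2,\ldots\}$; its size is $|M|=\sum_{a\in U}\mu_M(a)$, and $M_1\subseteq M_2$ means $\mu_{M_1}\leqslant\mu_{M_2}$ pointwise. For a finite multiset $B=\{\!\{b_1,\ldots,b_m\}\!\}$ over $\mathbb{F}_q^n$ (the $b_i$ are not necessarily distinct), the multispan $\operatorname{mspan}_q(B)$ is the multiset over $\mathbb{F}_q^n$ in which the multiplicity of $v$ is the number of $m$-tuples $(\alpha_1,\ldots,\alpha_m)\in\mathbb{F}_q^m$ with $\sum_{i=1}^m\alpha_i b_i=v$; if $B$ is empty, $\operatorname{mspan}_q(B)=\{0\}$ (with $0$ of multiplicity $1$). A multiset $W$ over $\mathbb{F}_q^n$ is a multispace over $\mathbb{F}_q^n$ if $W=\operatorname{mspan}_q(B)$ for some multiset $B$; then $\operatorname{rank}(W)=|B|=\log_q|W|$ and $\dim(W)=\dim(\operatorname{span}_q(B))$, where $\operatorname{span}_q$ is the ordinary linear span. $\mathcal{M}_q(n,m)$ is the collection of all rank-$m$ multispaces over $\mathbb{F}_q^n$ and $\mathcal{M}_q(n)=\bigcup_{m\geqslant 0}\mathcal{M}_q(n,m)$. In a poset, $y$ covers $x$ (and $x$ is covered by $y$) if $x\prec y$ and there is no $z$ with $x\prec z\prec y$. The Gaussian coefficient is $\binom{n}{k}_{\!q}=\frac{(q^n-1)\cdots(q^{n-k+1}-1)}{(q^k-1)\cdots(q-1)}$ (the number of $k$-dimensional subspaces of $\mathbb{F}_q^n$),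 with $\binom{n}{0}_{\!q}=1$ and $\binom{n}{k}_{\!q}=0$ for $k<0$ or $k>n$. Empty sums are $0$. *)

theory Defs
  imports "HOL-Analysis.Analysis" "HOL-Library.Multiset"
begin

text \<open>
  The field \<open>\<F>\<^sub>q\<close> is an arbitrary finite field type \<open>'a\<close> with \<open>q = CARD('a)\<close>, and
  \<open>\<F>\<^sub>q\<^sup>n\<close> is \<open>'a ^ 'n\<close> with \<open>n = CARD('n)\<close>.  As this universe is finite, the finite multisets
  of type \<open>('a ^ 'n) multiset\<close> are all the multisets over it.
\<close>

definition lin_comb :: "'a::field list \<Rightarrow> ('a ^ 'n::finite) list \<Rightarrow> 'a ^ 'n" where
  "lin_comb \<alpha>s bs = sum_list (map2 (*s) \<alpha>s bs)"

definition comb_tuples :: "('a::field ^ 'n::finite) list \<Rightarrow> 'a ^ 'n \<Rightarrow> 'a list set" where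
  "comb_tuples bs v = {\<alpha>s. length \<alpha>s = length bs \<and> lin_comb \<alpha>s bs = v}"

text \<open>
  Speaking of coefficient tuples presupposes an enumeration \<open>b\<^sub>1, \<dots>, b\<^sub>m\<close> of \<open>B\<close>;
  the result does not depend on it, see \<open>count_mspan\<close> below.
\<close>

definition mspan :: "('a::{field,finite} ^ 'n::finite) multiset \<Rightarrow> ('a ^ 'n) multiset" where
  "mspan B = (let bs = (SOME bs. mset bs = B) in Abs_multiset (\<lambda>v. card (comb_tuples bs v)))"

definition multispace :: "('a::{field,finite} ^ 'n::finite) multiset \<Rightarrow> bool" where
  "multispace W \<longleftrightarrow> (\<exists>B. W = mspan B)"

text \<open>Rank and dimension do not depend on the generating multiset, see \<open>mrank_mspan\<close> and \<open>mdim_mspan\<close>.\<close>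

definition mrank :: "('a::{field,finite} ^ 'n::finite) multiset \<Rightarrow> nat" where
  "mrank W = (THE m. \<exists>B. W = mspan B \<and> m = size B)"

definition mdim :: "('a::{field,finite} ^ 'n::finite) multiset \<Rightarrow> nat" where
  "mdim W = (THE d. \<exists>B. W = mspan B \<and> d = vec.dim (vec.span (set_mset B)))"

definition multispaces_of_rank :: "nat \<Rightarrow> ('a::{field,finite} ^ 'n::finite) multiset set" where
  "multispaces_of_rank m = {W. multispace W \<and> mrank W = m}"

definition multispaces :: "('a::{field,finite} ^ 'n::finite) multiset set" where
  "multispaces = (\<Union>m. multispaces_of_rank m)"

text \<open>\<open>mcovers y x\<close>: \<open>y\<close> covers \<open>x\<close> (the larger multispace comes first).\<close>

definition mcovers :: "('a::{field,finite} ^ 'n::finite) multiset \<Rightarrow> ('a ^ 'n) multiset \<Rightarrow> bool" where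
  "mcovers y x \<longleftrightarrow> x \<in> multispaces \<and> y \<in> multispaces \<and> x \<subset># y \<and>
     \<not> (\<exists>z \<in> multispaces. x \<subset># z \<and> z \<subset># y)"

definition gauss_coeff :: "nat \<Rightarrow> nat \<Rightarrow> nat \<Rightarrow> real" where
  "gauss_coeff q n k =
     (if k \<le> n then (\<Prod>i<k. real q ^ (n - i) - 1) / (\<Prod>i<k. real q ^ (k - i) - 1) else 0)"

lemma card_comb_tuples_cong:
  fixes bs cs :: "('a::{field,finite} ^ 'n::finite) list"
  assumes "mset bs = mset cs"
  shows "card (comb_tuples bs v) = card (comb_tuples cs v)"
proof -
  have le: "card (comb_tuples bs v) \<le> card (comb_tuples cs v)" if eq: "mset cs = mset bs"
    for bs cs :: "('a ^ 'n) list" and v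
  proof -
    obtain p where p: "p permutes {..<length bs}" "permute_list p bs = cs"
      using mset_eq_permutation[OF eq] by metis
    have fin: "finite (comb_tuples cs v)"
      using finite_lists_length_eq[of "UNIV :: 'a set" "length cs"]
      by (rule finite_subset[rotated]) (auto simp: comb_tuples_def)
    have "inj_on (permute_list p) (comb_tuples bs v)"
    proof (rule inj_onI)
      fix x y assume x: "x \<in> comb_tuples bs v" and y: "y \<in> comb_tuples bs v"
        and e: "permute_list p x = permute_list p y"
      have l: "length x = length bs" "length y = length bs"
        using x y by (auto simp: comb_tuples_def)
      show "x = y"
      proof (rule nth_equalityI)
        fix i assume "i < length x"
        then have "i \<in> p ` {..<length bs}" using p(1) l permutes_image by fastforce
        then obtain j where "j < length bs" "i = p j" by auto
        then show "x ! i = y ! i"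
          using e l p(1) permute_list_nth[of p x j] permute_list_nth[of p y j] by simp
      qed (use l in simp)
    qed
    moreover have "permute_list p ` comb_tuples bs v \<subseteq> comb_tuples cs v"
    proof clarify
      fix x assume x: "x \<in> comb_tuples bs v"
      then have l: "length x = length bs" by (auto simp: comb_tuples_def)
      have z: "zip (permute_list p x) cs = permute_list p (zip x bs)"
        unfolding p(2)[symmetric]
        by (rule permute_list_zip[symmetric, of p "{..<length bs}"]) (simp_all add: p(1) l)
      have "mset (permute_list p (zip x bs)) = mset (zip x bs)"
        by (rule mset_permute_list) (simp add: p(1) l)
      then have "mset (map2 (*s) (permute_list p x) cs) = mset (map2 (*s) x bs)"
        by (simp only: z mset_map)
      then have "lin_comb (permute_list p x) cs = lin_comb x bs"
        unfolding lin_comb_def by (simp only: sum_mset_sum_list[symmetric])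
      then show "permute_list p x \<in> comb_tuples cs v"
        using x l p(2) by (auto simp: comb_tuples_def)
    qed
    ultimately show ?thesis using fin by (meson card_inj_on_le)
  qed
  show ?thesis using le[of bs cs v] le[of cs bs v] assms by simp
qed

lemma count_mspan: "count (mspan (mset bs)) v = card (comb_tuples bs v)"
proof -
  have "mset (SOME cs. mset cs = mset bs) = mset bs" by (rule someI) simp
  from card_comb_tuples_cong[OF this, of v] show ?thesis
    by (simp add: mspan_def Let_def)
qed

lemma mspan_empty: "mspan {#} = {#0#}"
proof (rule multiset_eqI)
  fix v :: "'a ^ 'n"
  have "comb_tuples ([] :: ('a ^ 'n) list) v = (if v = 0 then {[]} else {})"
    by (auto simp: comb_tuples_def lin_comb_def)
  then show "count (mspan {#}) v = count {#0#} v"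
    using count_mspan[of "[]" v] by simp
qed

lemma size_mspan:
  fixes B :: "('a::{field,finite} ^ 'n::finite) multiset"
  shows "size (mspan B) = CARD('a) ^ size B"
proof -
  obtain bs where bs: "B = mset bs" by (metis ex_mset)
  have fin: "finite {\<alpha>s :: 'a list. length \<alpha>s = length bs}"
    using finite_lists_length_eq[of "UNIV :: 'a set" "length bs"] by simp
  have "size (mspan B) = (\<Sum>v\<in>UNIV. count (mspan B) v)"
    unfolding size_multiset_overloaded_eq
    by (rule sum.mono_neutral_left) (auto simp: not_in_iff)
  also have "\<dots> = (\<Sum>v\<in>UNIV. card (comb_tuples bs v))" by (simp add: bs count_mspan)
  also have "\<dots> = card (\<Union>v. comb_tuples bs v)"
    using fin by (subst card_UN_disjoint) (auto simp: comb_tuples_def)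
  also have "(\<Union>v. comb_tuples bs v) = {\<alpha>s. length \<alpha>s = length bs}"
    by (auto simp: comb_tuples_def)
  also have "card \<dots> = CARD('a) ^ size B"
    using card_lists_length_eq[of "UNIV :: 'a set" "length bs"] by (simp add: bs)
  finally show ?thesis .
qed

lemma set_mset_mspan: "set_mset (mspan B) = vec.span (set_mset B)"
proof -
  have ne: "comb_tuples bs v \<noteq> {} \<longleftrightarrow> v \<in> vec.span (set bs)"
    for bs :: "('a::{field,finite} ^ 'n::finite) list" and v
  proof (induction bs arbitrary: v)
    case Nil
    then show ?case by (auto simp: comb_tuples_def lin_comb_def)
  next
    case (Cons b bs)
    have "comb_tuples (b # bs) v \<noteq> {} \<longleftrightarrow> (\<exists>k. comb_tuples bs (v - k *s b) \<noteq> {})"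
      (is "?L \<longleftrightarrow> ?R")
    proof
      assume ?L
      then obtain ls where ls: "ls \<in> comb_tuples (b # bs) v" by blast
      then obtain k ks where "ls = k # ks" by (cases ls) (auto simp: comb_tuples_def)
      with ls have "length ks = length bs" "k *s b + lin_comb ks bs = v"
        by (simp_all add: comb_tuples_def lin_comb_def)
      then have "ks \<in> comb_tuples bs (v - k *s b)" by (auto simp: comb_tuples_def)
      then show ?R by blast
    next
      assume ?R
      then obtain k ks where "ks \<in> comb_tuples bs (v - k *s b)" by blast
      then have "k # ks \<in> comb_tuples (b # bs) v" by (auto simp: comb_tuples_def lin_comb_def)
      then show ?L by blast
    qed
    then show ?case by (simp add: Cons.IH vec.span_breakdown_eq)
  qed
  obtain bs where bs: "B = mset bs" by (metis ex_mset)
  have fin: "finite (comb_tuples bs v)" for v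
    using finite_lists_length_eq[of "UNIV :: 'a set" "length bs"]
    by (rule finite_subset[rotated]) (auto simp: comb_tuples_def)
  have "v \<in># mspan B \<longleftrightarrow> comb_tuples bs v \<noteq> {}" for v
    by (metis bs card_eq_0_iff count_eq_zero_iff count_mspan fin)
  then show ?thesis using ne bs by auto
qed

lemma mrank_mspan: "mrank (mspan B) = size B"
proof -
  have "size C = size B" if "mspan B = mspan C" for C
  proof -
    have "CARD('a) ^ size C = CARD('a) ^ size B" by (metis size_mspan that)
    moreover have "CARD('a) > 1"
      using card_mono[of UNIV "{0, 1 :: 'a}"] by simp
    ultimately show ?thesis by simp
  qed
  then show ?thesis unfolding mrank_def by (intro the_equality) blast+
qed

lemma mdim_mspan: "mdim (mspan B) = vec.dim (vec.span (set_mset B))"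
  unfolding mdim_def
proof (rule the_equality)
  show "\<exists>C. mspan B = mspan C \<and> vec.dim (vec.span (set_mset B)) = vec.dim (vec.span (set_mset C))"
    by blast
next
  fix d assume "\<exists>C. mspan B = mspan C \<and> d = vec.dim (vec.span (set_mset C))"
  then obtain C where C: "mspan B = mspan C" "d = vec.dim (vec.span (set_mset C))" by blast
  have "vec.span (set_mset C) = vec.span (set_mset B)"
    using C(1) set_mset_mspan[of B] set_mset_mspan[of C] by (simp only:)
  then show "d = vec.dim (vec.span (set_mset B))" using C(2) by (simp only:)
qed

end

theory Submission
  imports Defs
begin

text \<open>
  A multispace is constant on its support: \<open>mspan B\<close> is the subspace \<open>V = span B\<close> in which every
  vector is repeated \<open>q ^ e\<close> times, \<open>e = |B| - dim V\<close>, because the coefficient tuples representing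
  a vector of \<open>V\<close> form a coset of those representing \<open>0\<close>. Conversely every pair of a subspace
  \<open>V\<close> and a number \<open>e\<close> occurs, and inclusion of multispaces is the product order on these pairs.
  A cover therefore either raises \<open>e\<close> by one or replaces \<open>V\<close> by a subspace of one dimension more,
  and the three counts reduce to counting subspaces.
\<close>

section \<open>Counting subspaces over a finite field\<close>

lemma card_field_gt_1: "CARD('a::{field,finite}) > 1"
  using card_mono[of UNIV "{0, 1 :: 'a}"] by simp

text \<open>Every vector of the larger span is \<open>s + k *s b\<close> for exactly one pair
  \<open>(k, s)\<close>: two representations with different coefficients would exhibit a nonzero
  multiple of \<open>b\<close>, hence \<open>b\<close> itself, as an element of
  \<open>vec.span S\<close>.\<close>

lemma card_span_insert:
  fixes S :: "('a::{field,finite} ^ 'n::finite) set"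
  assumes "b \<notin> vec.span S"
  shows "card (vec.span (insert b S)) = CARD('a) * card (vec.span S)"
proof -
  let ?f = "\<lambda>(k, s). s + k *s b"
  have "inj_on ?f (UNIV \<times> vec.span S)"
  proof (rule inj_onI, clarify)
    fix k l s t assume s: "s \<in> vec.span S" and t: "t \<in> vec.span S" and e: "s + k *s b = t + l *s b"
    have "(k - l) *s b = t - s"
      using e by (simp add: algebra_simps vec.scale_left_diff_distrib)
    then have d: "(k - l) *s b \<in> vec.span S" by (simp add: s t vec.span_diff)
    have "k = l"
    proof (rule ccontr)
      assume "k \<noteq> l"
      then have "b = inverse (k - l) *s ((k - l) *s b)"
        by (simp only: vec.scale_scale left_inverse right_minus_eq vec.scale_one not_False_eq_True)
      then show False using assms d vec.span_scale by metis
    qed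
    then show "k = l \<and> s = t" using e by simp
  qed
  moreover have "?f ` (UNIV \<times> vec.span S) = vec.span (insert b S)"
  proof (intro set_eqI iffI)
    fix x assume "x \<in> ?f ` (UNIV \<times> vec.span S)"
    then obtain k s where "s \<in> vec.span S" "x = s + k *s b" by auto
    then have "x - k *s b \<in> vec.span S" by simp
    then show "x \<in> vec.span (insert b S)" unfolding vec.span_breakdown_eq by blast
  next
    fix x assume "x \<in> vec.span (insert b S)"
    then obtain k where k: "x - k *s b \<in> vec.span S" unfolding vec.span_breakdown_eq by blast
    show "x \<in> ?f ` (UNIV \<times> vec.span S)"
      by (rule image_eqI[of _ _ "(k, x - k *s b)"]) (simp_all add: k)
  qed
  ultimately show ?thesis by (metis card_image card_cartesian_product)
qed

lemma card_span_independent: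
  fixes B :: "('a::{field,finite} ^ 'n::finite) set"
  assumes "vec.independent B"
  shows "card (vec.span B) = CARD('a) ^ card B"
  using finite[of B] assms
proof (induction B rule: finite_induct)
  case (insert b B)
  then show ?case by (simp add: vec.independent_insert card_span_insert)
qed simp

lemma card_subspace:
  fixes V :: "('a::{field,finite} ^ 'n::finite) set"
  assumes "vec.subspace V"
  shows "card V = CARD('a) ^ vec.dim V"
proof -
  obtain B where B: "B \<subseteq> V" "vec.independent B" "V \<subseteq> vec.span B" "card B = vec.dim V"
    using vec.basis_exists by blast
  then have "vec.span B = V" using assms vec.span_minimal by blast
  then show ?thesis using card_span_independent[OF B(2)] B(4) by simp
qed

section \<open>Subspaces of a given dimension, counted through ordered bases\<close>

definition subspaces_within :: "('a::{field,finite} ^ 'n::finite) set \<Rightarrow> nat \<Rightarrow> ('a ^ 'n) set set" where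
  "subspaces_within U k = {S. vec.subspace S \<and> S \<subseteq> U \<and> vec.dim S = k}"

text \<open>Lists serve as ordered bases: they grow by one entry at a time, and the number of
  choices for the next entry depends only on the length reached so far.\<close>

definition indep_lists :: "('a::{field,finite} ^ 'n::finite) set \<Rightarrow> nat \<Rightarrow> ('a ^ 'n) list set" where
  "indep_lists U k = {xs. length xs = k \<and> distinct xs \<and> vec.independent (set xs) \<and> set xs \<subseteq> U}"

lemma finite_indep_lists: "finite (indep_lists U k)"
  by (rule finite_subset[OF _ finite_lists_length_eq[of UNIV k]]) (auto simp: indep_lists_def)

lemma dim_span_set_indep_lists: "xs \<in> indep_lists U k \<Longrightarrow> vec.dim (vec.span (set xs)) = k"
  by (simp add: indep_lists_def vec.dim_eq_card_independent distinct_card vec.dim_span)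

text \<open>An independent list of length \<open>k\<close> in \<open>U\<close> spans
  \<open>q ^ k\<close> vectors of \<open>U\<close>, and any of the remaining ones may be put in
  front of it. For \<open>k > vec.dim U\<close> the factor with \<open>i = vec.dim U\<close> makes
  the product 0, in accordance with the absence of such lists.\<close>

lemma card_indep_lists:
  fixes U :: "('a::{field,finite} ^ 'n::finite) set"
  assumes "vec.subspace U"
  shows "card (indep_lists U k) = (\<Prod>i<k. CARD('a) ^ vec.dim U - CARD('a) ^ i)"
proof (induction k)
  case 0
  have "indep_lists U 0 = {[]}" by (auto simp: indep_lists_def vec.independent_empty)
  then show ?case by simp
next
  case (Suc k)
  have "indep_lists U (Suc k) =
      (\<lambda>(xs, x). x # xs) ` (SIGMA xs:indep_lists U k. U - vec.span (set xs))"
  proof (intro set_eqI iffI)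
    fix ys assume ys: "ys \<in> indep_lists U (Suc k)"
    then obtain x xs where e: "ys = x # xs" by (cases ys) (auto simp: indep_lists_def)
    have "(xs, x) \<in> (SIGMA xs:indep_lists U k. U - vec.span (set xs))"
      using ys by (auto simp: e indep_lists_def vec.independent_insert)
    then show "ys \<in> (\<lambda>(xs, x). x # xs) ` (SIGMA xs:indep_lists U k. U - vec.span (set xs))"
      unfolding e by force
  next
    fix ys assume "ys \<in> (\<lambda>(xs, x). x # xs) ` (SIGMA xs:indep_lists U k. U - vec.span (set xs))"
    then obtain x xs where *: "ys = x # xs" "xs \<in> indep_lists U k" "x \<in> U" "x \<notin> vec.span (set xs)"
      by auto
    then have "vec.independent (set xs)" by (simp add: indep_lists_def)
    with *(4) have "vec.independent (insert x (set xs))" by (rule vec.independent_insertI)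
    moreover have "x \<notin> set xs" using *(4) vec.span_base by blast
    ultimately show "ys \<in> indep_lists U (Suc k)" using * by (simp add: indep_lists_def)
  qed
  moreover have "inj_on (\<lambda>(xs, x). x # xs) (SIGMA xs:indep_lists U k. U - vec.span (set xs))"
    by (auto simp: inj_on_def)
  ultimately have "card (indep_lists U (Suc k)) =
      card (SIGMA xs:indep_lists U k. U - vec.span (set xs))"
    by (simp only: card_image)
  also have "\<dots> = (\<Sum>xs\<in>indep_lists U k. card (U - vec.span (set xs)))"
    by (rule card_SigmaI) (simp_all add: finite_indep_lists)
  also have "\<dots> = (\<Sum>xs\<in>indep_lists U k. CARD('a) ^ vec.dim U - CARD('a) ^ k)"
  proof (rule sum.cong[OF refl])
    fix xs assume xs: "xs \<in> indep_lists U k"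
    then have "vec.span (set xs) \<subseteq> U"
      using assms vec.span_minimal by (auto simp: indep_lists_def)
    then show "card (U - vec.span (set xs)) = CARD('a) ^ vec.dim U - CARD('a) ^ k"
      using card_subspace[OF assms] card_subspace[OF vec.subspace_span, of "set xs"]
        dim_span_set_indep_lists[OF xs]
      by (simp add: card_Diff_subset)
  qed
  finally show ?case by (simp add: Suc.IH)
qed

text \<open>Double counting of the independent lists of length \<open>k\<close> in \<open>U\<close>:
  each is an ordered basis of exactly one subspace of dimension \<open>k\<close>, and every such
  subspace has the same number of ordered bases. The product form avoids division of natural
  numbers.\<close>

lemma card_subspaces_within_mult:
  fixes U :: "('a::{field,finite} ^ 'n::finite) set"
  assumes "vec.subspace U"
  shows "card (subspaces_within U k) * (\<Prod>i<k. CARD('a) ^ k - CARD('a) ^ i) =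
    (\<Prod>i<k. CARD('a) ^ vec.dim U - CARD('a) ^ i)"
proof -
  \<comment> \<open>A list determines the subspace of which it is a basis, so the families of
    ordered bases are pairwise disjoint.\<close>
  have span_eq: "vec.span (set xs) = S" if "xs \<in> indep_lists S k" "S \<in> subspaces_within U k" for xs S
    using that vec.span_minimal[of "set xs" S] dim_span_set_indep_lists[of xs S k]
      vec.subspace_dim_equal[of "vec.span (set xs)" S]
    by (auto simp: indep_lists_def subspaces_within_def)
  have "indep_lists U k = (\<Union>S\<in>subspaces_within U k. indep_lists S k)"
  proof (intro set_eqI iffI)
    fix xs assume xs: "xs \<in> indep_lists U k"
    then have "vec.span (set xs) \<in> subspaces_within U k"
      using assms vec.span_minimal dim_span_set_indep_lists[OF xs]
      by (auto simp: subspaces_within_def indep_lists_def)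
    moreover have "xs \<in> indep_lists (vec.span (set xs)) k"
      using xs by (auto simp: indep_lists_def vec.span_base)
    ultimately show "xs \<in> (\<Union>S\<in>subspaces_within U k. indep_lists S k)" by blast
  qed (auto simp: indep_lists_def subspaces_within_def)
  also have "card \<dots> = (\<Sum>S\<in>subspaces_within U k. card (indep_lists S k))"
    by (rule card_UN_disjoint) (use span_eq in \<open>auto simp: finite_indep_lists\<close>)
  also have "\<dots> = (\<Sum>S\<in>subspaces_within U k. \<Prod>i<k. CARD('a) ^ k - CARD('a) ^ i)"
    by (rule sum.cong) (auto simp: subspaces_within_def card_indep_lists)
  finally show ?thesis using card_indep_lists[OF assms, of k] by simp
qed

theorem card_subspaces_within:
  fixes U :: "('a::{field,finite} ^ 'n::finite) set"
  assumes "vec.subspace U"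
  shows "real (card (subspaces_within U k)) = gauss_coeff CARD('a) (vec.dim U) k"
proof (cases "k \<le> vec.dim U")
  case True
  define q where "q = CARD('a)"
  have q: "real q > 1" using card_field_gt_1[where 'a='a] by (simp add: q_def)
  \<comment> \<open>Taking \<open>q ^ i\<close> out of each factor brings both products of the
    double count (\<open>m = vec.dim U\<close> and \<open>m = k\<close>) into the shape of
    \<open>gauss_coeff\<close>, up to a common factor that cancels in the quotient.\<close>
  have fact: "real (\<Prod>i<k. q ^ m - q ^ i) = (\<Prod>i<k. real q ^ i) * (\<Prod>i<k. real q ^ (m - i) - 1)"
    if "k \<le> m" for m
  proof -
    have "real (q ^ m - q ^ i) = real q ^ i * (real q ^ (m - i) - 1)" if "i < k" for i
    proof -
      have "q ^ i \<le> q ^ m" using q that \<open>k \<le> m\<close> by (intro power_increasing) auto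
      moreover have "real q ^ m = real q ^ i * real q ^ (m - i)"
        using that \<open>k \<le> m\<close> by (simp flip: power_add)
      ultimately show ?thesis by (simp add: of_nat_diff right_diff_distrib)
    qed
    then show ?thesis by (simp add: prod.distrib)
  qed
  have "real q ^ (k - i) - 1 > 0" if "i < k" for i
    using one_less_power[OF q, of "k - i"] that by simp
  then have "(\<Prod>i<k. real q ^ (k - i) - 1) > 0" by (intro prod_pos) simp
  then have nz: "(\<Prod>i<k. real q ^ (k - i) - 1) \<noteq> 0" by linarith
  have nz': "(\<Prod>i<k. real q ^ i) \<noteq> 0" using q by simp
  have "real (card (subspaces_within U k)) * real (\<Prod>i<k. q ^ k - q ^ i) =
      real (\<Prod>i<k. q ^ vec.dim U - q ^ i)"
    using card_subspaces_within_mult[OF assms, of k] unfolding q_def by (metis of_nat_mult)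
  then show ?thesis
    using nz nz' True unfolding fact[OF True] fact[OF order_refl]
    by (simp add: gauss_coeff_def field_simps flip: q_def)
next
  case False
  then have "subspaces_within U k = {}"
    using vec.dim_subset by (auto simp: subspaces_within_def)
  then show ?thesis using False by (simp add: gauss_coeff_def)
qed

section \<open>Subspaces one dimension below or above a given one\<close>

text \<open>The product \<open>P (Suc d)\<close> is evaluated twice: splitting off its first factor
  leaves \<open>P d\<close>, splitting off its last factor \<open>q - 1\<close> leaves the numerator
  \<open>A\<close>. So \<open>A / P d\<close> is the closed form of the geometric sum.\<close>

lemma gauss_coeff_hyperplanes:
  assumes "q > 1"
  shows "gauss_coeff q (Suc d) d = real (\<Sum>i<Suc d. q ^ i)"
proof -
  define P where "P = (\<lambda>d. \<Prod>i<d. real q ^ (d - i) - 1)"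
  define A where "A = (\<Prod>i<d. real q ^ (Suc d - i) - 1)"
  define s where "s = real (\<Sum>i<Suc d. q ^ i)"
  have q: "real q > 1" using assms by simp
  have "real q ^ (d - i) - 1 > 0" if "i < d" for i
    using one_less_power[OF q, of "d - i"] that by simp
  then have "P d > 0" unfolding P_def by (intro prod_pos) simp
  have "s * (real q - 1) = real q ^ Suc d - 1"
    using power_diff_1_eq[of "real q" "Suc d"] unfolding s_def of_nat_sum of_nat_power
    by (metis mult.commute)
  moreover have "P (Suc d) = (real q ^ Suc d - 1) * P d"
    unfolding P_def by (subst prod.lessThan_Suc_shift) simp
  moreover have "P (Suc d) = A * (real q - 1)"
    unfolding P_def A_def by simp
  ultimately have "A * (real q - 1) = (s * (real q - 1)) * P d" by (simp only:)
  then have "A * (real q - 1) = (s * P d) * (real q - 1)" by (simp only: mult_ac)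
  then have "A = s * P d" using q by simp
  moreover have "gauss_coeff q (Suc d) d = A / P d"
    by (simp add: gauss_coeff_def A_def P_def)
  ultimately show ?thesis using \<open>P d > 0\<close> by (simp add: s_def)
qed

text \<open>The codimension is expressed through \<open>Suc\<close>, because with truncated
  subtraction the zero space would count as a hyperplane of itself.\<close>

lemma card_hyperplanes:
  fixes U :: "('a::{field,finite} ^ 'n::finite) set"
  assumes "vec.subspace U"
  shows "card {S. vec.subspace S \<and> S \<subseteq> U \<and> vec.dim U = Suc (vec.dim S)} =
    (\<Sum>i<vec.dim U. CARD('a) ^ i)"
proof (cases "vec.dim U")
  case (Suc d)
  have "{S. vec.subspace S \<and> S \<subseteq> U \<and> Suc d = Suc (vec.dim S)} = subspaces_within U d"
    by (auto simp: subspaces_within_def)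
  moreover have "real (card (subspaces_within U d)) = real (\<Sum>i<Suc d. CARD('a) ^ i)"
    using card_subspaces_within[OF assms, of d] gauss_coeff_hyperplanes[OF card_field_gt_1]
    by (simp only: Suc)
  ultimately show ?thesis unfolding Suc of_nat_eq_iff by (simp only:)
next
  case 0
  show ?thesis unfolding 0 by simp
qed

lemma dim_span_insert_subspace:
  fixes V :: "('a::field ^ 'n::finite) set"
  assumes "vec.subspace V" "x \<notin> V"
  shows "vec.dim (vec.span (insert x V)) = Suc (vec.dim V)"
  using assms by (simp add: vec.dim_span vec.dim_insert vec.span_eq_iff[THEN iffD2])

text \<open>No quotient space is formed. Each \<open>x\<close> outside \<open>V\<close> lies in
  exactly one of the subspaces in question, namely \<open>vec.span (insert x V)\<close>, so the sets
  \<open>S - V\<close> partition the complement of \<open>V\<close> into blocks of equal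
  size.\<close>

lemma card_upper_hyperplanes:
  fixes V :: "('a::{field,finite} ^ 'n::finite) set"
  assumes V: "vec.subspace V"
  shows "card {S. vec.subspace S \<and> V \<subseteq> S \<and> vec.dim S = Suc (vec.dim V)} =
    (\<Sum>i<CARD('n) - vec.dim V. CARD('a) ^ i)"
proof -
  define q d where "q = CARD('a)" and "d = vec.dim V"
  define C where "C = {S. vec.subspace S \<and> V \<subseteq> S \<and> vec.dim S = Suc (vec.dim V)}"
  have q: "q > 1" unfolding q_def by (rule card_field_gt_1)
  have d: "d \<le> CARD('n)"
    using vec.dim_subset[OF subset_UNIV, of V] by (simp only: d_def vec_dim_card)
  have span_eq: "S = vec.span (insert x V)" if "S \<in> C" "x \<in> S - V" for S x
    using that dim_span_insert_subspace[OF V, of x] vec.span_minimal[of "insert x V" S]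
      vec.subspace_dim_equal[of "vec.span (insert x V)" S]
    by (auto simp: C_def)
  have "- V = (\<Union>S\<in>C. S - V)"
  proof (intro set_eqI iffI)
    fix x assume "x \<in> - V"
    then have "vec.span (insert x V) \<in> C" "x \<in> vec.span (insert x V)"
      using dim_span_insert_subspace[OF V, of x] vec.span_superset[of "insert x V"]
      by (auto simp: C_def)
    then show "x \<in> (\<Union>S\<in>C. S - V)" using \<open>x \<in> - V\<close> by blast
  qed auto
  also have "card \<dots> = (\<Sum>S\<in>C. card (S - V))"
    by (rule card_UN_disjoint) (use span_eq in \<open>simp_all, blast\<close>)
  also have "\<dots> = (\<Sum>S\<in>C. q ^ Suc d - q ^ d)"
    by (rule sum.cong)
      (auto simp: C_def card_Diff_subset card_subspace V q_def d_def)
  finally have "card (- V) = card C * (q ^ Suc d - q ^ d)" by simp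
  moreover have "card (- V) = q ^ CARD('n) - q ^ d"
    using card_subspace[OF V] by (simp add: Compl_eq_Diff_UNIV card_Diff_subset q_def d_def)
  ultimately have "real (q ^ CARD('n) - q ^ d) = real (card C) * real (q ^ Suc d - q ^ d)"
    by (simp only: flip: of_nat_mult)
  \<comment> \<open>With these bounds the truncated differences become real ones, and the factors
    \<open>q ^ d\<close> and \<open>q - 1\<close> can be cancelled.\<close>
  moreover have "q ^ d \<le> q ^ CARD('n)" "q ^ d \<le> q ^ Suc d"
    using q d by (auto intro: power_increasing)
  ultimately have "real q ^ CARD('n) - real q ^ d = real (card C) * (real q ^ Suc d - real q ^ d)"
    by (simp only: of_nat_diff of_nat_power)
  moreover have "real q ^ CARD('n) = real q ^ d * real q ^ (CARD('n) - d)"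
    using d by (simp flip: power_add)
  ultimately have "real q ^ d * (real q ^ (CARD('n) - d) - 1) =
      real q ^ d * (real (card C) * (real q - 1))"
    by (simp add: algebra_simps)
  then have "real (card C) * (real q - 1) = real q ^ (CARD('n) - d) - 1" using q by simp
  also have "\<dots> = real (\<Sum>i<CARD('n) - d. q ^ i) * (real q - 1)"
    using power_diff_1_eq[of "real q" "CARD('n) - d"] unfolding of_nat_sum of_nat_power
    by (metis mult.commute)
  finally have "real (card C) = real (\<Sum>i<CARD('n) - d. q ^ i)" using q by simp
  then show ?thesis unfolding of_nat_eq_iff C_def q_def d_def .
qed

section \<open>Multispaces as pairs of a subspace and an exponent\<close>

definition uniform_mset :: "('a::{field,finite} ^ 'n::finite) set \<Rightarrow> nat \<Rightarrow> ('a ^ 'n) multiset" where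
  "uniform_mset V e = repeat_mset (CARD('a) ^ e) (mset_set V)"

lemma count_uniform_mset:
  "count (uniform_mset V e) v = (if v \<in> V then CARD('a) ^ e else 0)"
  for V :: "('a::{field,finite} ^ 'n::finite) set"
  by (simp add: uniform_mset_def)

lemma uniform_mset_subseteq_iff:
  fixes U V :: "('a::{field,finite} ^ 'n::finite) set"
  assumes "vec.subspace V"
  shows "uniform_mset V e \<subseteq># uniform_mset U f \<longleftrightarrow> V \<subseteq> U \<and> e \<le> f"
proof
  assume *: "uniform_mset V e \<subseteq># uniform_mset U f"
  have le: "count (uniform_mset V e) v \<le> count (uniform_mset U f) v" for v
    using * by (simp add: subseteq_mset_def)
  have "V \<subseteq> U"
  proof
    fix v assume "v \<in> V"
    then show "v \<in> U" using le[of v] by (simp add: count_uniform_mset split: if_splits)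
  qed
  \<comment> \<open>The vector 0 lies in \<open>V\<close>, hence in \<open>U\<close>, and its two
    multiplicities compare the exponents.\<close>
  moreover have "e \<le> f"
    using le[of 0] vec.subspace_0[OF assms] card_field_gt_1[where 'a='a] \<open>V \<subseteq> U\<close>
    by (auto simp: count_uniform_mset)
  ultimately show "V \<subseteq> U \<and> e \<le> f" ..
next
  assume "V \<subseteq> U \<and> e \<le> f"
  then show "uniform_mset V e \<subseteq># uniform_mset U f"
    using card_field_gt_1[where 'a='a]
    by (auto simp: subseteq_mset_def count_uniform_mset intro!: power_increasing)
qed

lemma uniform_mset_eq_iff:
  assumes "vec.subspace V" "vec.subspace U"
  shows "uniform_mset V e = uniform_mset U f \<longleftrightarrow> V = U \<and> e = f"
  using uniform_mset_subseteq_iff[OF assms(1), of e U f] uniform_mset_subseteq_iff[OF assms(2), of f V e]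
  by (auto simp: subset_mset.order_eq_iff)

lemma uniform_mset_subset_iff:
  assumes "vec.subspace V" "vec.subspace U"
  shows "uniform_mset V e \<subset># uniform_mset U f \<longleftrightarrow> V \<subseteq> U \<and> e \<le> f \<and> (V \<noteq> U \<or> e \<noteq> f)"
  using uniform_mset_subseteq_iff[OF assms(1)] uniform_mset_eq_iff[OF assms]
  by (auto simp: subset_mset.less_le)

section \<open>Multiplicities in a multispan\<close>

lemma lin_comb_add:
  assumes "length xs = length bs" "length ys = length bs"
  shows "lin_comb (map2 (+) xs ys) bs = lin_comb xs bs + lin_comb ys bs"
  using assms
proof (induction bs arbitrary: xs ys)
  case (Cons b bs)
  then obtain x xs' y ys' where "xs = x # xs'" "ys = y # ys'" by (metis length_Suc_conv)
  then show ?case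
    using Cons by (simp add: lin_comb_def vec.scale_left_distrib algebra_simps)
qed (simp add: lin_comb_def)

lemma inj_on_map2_add:
  fixes ys :: "'a::cancel_ab_semigroup_add list"
  shows "inj_on (\<lambda>xs. map2 (+) xs ys) {xs. length xs = length ys}"
proof (rule inj_onI)
  fix xs zs assume "xs \<in> {xs. length xs = length ys}" "zs \<in> {xs. length xs = length ys}"
    and e: "map2 (+) xs ys = map2 (+) zs ys"
  then have l: "length xs = length ys" "length zs = length ys" by auto
  show "xs = zs"
  proof (rule nth_equalityI)
    fix i assume "i < length xs"
    then show "xs ! i = zs ! i" using arg_cong[OF e, of "\<lambda>l. l ! i"] l by simp
  qed (simp add: l)
qed

lemma finite_comb_tuples:
  fixes bs :: "('a::{field,finite} ^ 'n::finite) list"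
  shows "finite (comb_tuples bs v)"
  using finite_lists_length_eq[of "UNIV :: 'a set" "length bs"]
  by (rule finite_subset[rotated]) (auto simp: comb_tuples_def)

text \<open>Adding one fixed representation of \<open>w - v\<close> maps the representations of
  \<open>v\<close> injectively to representations of \<open>w\<close>.\<close>

lemma card_comb_tuples_le:
  fixes bs :: "('a::{field,finite} ^ 'n::finite) list"
  assumes "comb_tuples bs (w - v) \<noteq> {}"
  shows "card (comb_tuples bs v) \<le> card (comb_tuples bs w)"
proof -
  obtain ys where ys: "length ys = length bs" "lin_comb ys bs = w - v"
    using assms by (auto simp: comb_tuples_def)
  have "inj_on (\<lambda>xs. map2 (+) xs ys) (comb_tuples bs v)"
    by (rule inj_on_subset[OF inj_on_map2_add]) (auto simp: comb_tuples_def ys)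
  moreover have "(\<lambda>xs. map2 (+) xs ys) ` comb_tuples bs v \<subseteq> comb_tuples bs w"
    by (auto simp: comb_tuples_def lin_comb_add ys)
  ultimately show ?thesis using finite_comb_tuples by (rule card_inj_on_le)
qed

text \<open>The span contains both \<open>v\<close> and \<open>- v\<close>, so representations can
  be translated from 0 to \<open>v\<close> and back, which gives both inequalities.\<close>

lemma count_mspan_const:
  assumes "v \<in> vec.span (set_mset B)"
  shows "count (mspan B) v = count (mspan B) 0"
proof -
  obtain bs where bs: "B = mset bs" by (metis ex_mset)
  have ne: "comb_tuples bs w \<noteq> {}" if "w \<in> vec.span (set_mset B)" for w
    using that set_mset_mspan[of B] count_mspan[of bs w]
    by (metis bs card.empty count_eq_zero_iff)
  have "v - 0 \<in> vec.span (set_mset B)" "0 - v \<in> vec.span (set_mset B)"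
    using assms by (simp_all add: vec.span_neg)
  then show ?thesis
    using card_comb_tuples_le[of bs 0 v] card_comb_tuples_le[of bs v 0] ne
    by (simp add: bs count_mspan order.antisym)
qed

text \<open>Comparing sizes, \<open>q ^ size B\<close> is \<open>q ^ vec.dim V\<close> times the
  common multiplicity, where \<open>V\<close> is the span of \<open>B\<close>. Hence that
  multiplicity is the power of \<open>q\<close> whose exponent is the excess of
  \<open>size B\<close> over the dimension.\<close>

lemma mspan_eq_uniform_mset:
  fixes B :: "('a::{field,finite} ^ 'n::finite) multiset"
  shows "\<exists>e. mspan B = uniform_mset (vec.span (set_mset B)) e \<and>
    size B = vec.dim (vec.span (set_mset B)) + e"
proof -
  let ?V = "vec.span (set_mset B)" and ?c = "count (mspan B) 0" and ?q = "CARD('a)"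
  have out: "count (mspan B) v = 0" if "v \<notin> ?V" for v
    using that set_mset_mspan[of B] by (metis count_eq_zero_iff)
  have "size (mspan B) = (\<Sum>v\<in>?V. count (mspan B) v)"
    unfolding size_multiset_overloaded_eq set_mset_mspan ..
  also have "\<dots> = card ?V * ?c" using count_mspan_const[of _ B] by simp
  finally have size: "?q ^ size B = ?q ^ vec.dim ?V * ?c"
    by (simp add: size_mspan card_subspace)
  have "vec.dim ?V \<le> card (set_mset B)"
    by (rule vec.dim_le_card) simp_all
  also have "\<dots> \<le> size B" by (metis mset_set_set_mset_msubset size_mset_mono size_mset_set)
  finally obtain e where e: "size B = vec.dim ?V + e" using le_Suc_ex by blast
  have "?c = ?q ^ e" using size by (simp add: e power_add)
  then have "mspan B = uniform_mset ?V e"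
    by (intro multiset_eqI) (simp add: count_uniform_mset out count_mspan_const)
  then show ?thesis using e by blast
qed

lemma uniform_mset_is_mspan:
  fixes V :: "('a::{field,finite} ^ 'n::finite) set"
  assumes "vec.subspace V"
  obtains B where "uniform_mset V e = mspan B" "size B = vec.dim V + e" "vec.span (set_mset B) = V"
proof -
  obtain S where S: "S \<subseteq> V" "vec.independent S" "V \<subseteq> vec.span S" "card S = vec.dim V"
    using vec.basis_exists by blast
  \<comment> \<open>Each copy of the zero vector raises the size by one and leaves the span
    unchanged, so a basis padded with \<open>e\<close> zeros has the wanted excess
    \<open>e\<close>.\<close>
  define B where "B = mset_set S + replicate_mset e 0"
  have "vec.span (set_mset B) = vec.span S"
    by (auto simp: B_def vec.span_insert_0)
  also have "\<dots> = V" using S assms vec.span_minimal by blast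
  finally have span: "vec.span (set_mset B) = V" .
  have size: "size B = vec.dim V + e" by (simp add: B_def S)
  show thesis
    using mspan_eq_uniform_mset[of B] by (intro that[OF _ size span]) (auto simp: span size)
qed

lemma mrank_uniform_mset: "vec.subspace V \<Longrightarrow> mrank (uniform_mset V e) = vec.dim V + e"
  by (metis uniform_mset_is_mspan mrank_mspan)

lemma mdim_uniform_mset: "vec.subspace V \<Longrightarrow> mdim (uniform_mset V e) = vec.dim V"
  by (metis uniform_mset_is_mspan mdim_mspan)

lemma multispace_iff: "multispace W \<longleftrightarrow> (\<exists>V e. vec.subspace V \<and> W = uniform_mset V e)"
proof
  assume "multispace W"
  then obtain B where "W = mspan B" unfolding multispace_def ..
  then show "\<exists>V e. vec.subspace V \<and> W = uniform_mset V e"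
    using mspan_eq_uniform_mset[of B] vec.subspace_span by metis
next
  assume "\<exists>V e. vec.subspace V \<and> W = uniform_mset V e"
  then show "multispace W" unfolding multispace_def by (metis uniform_mset_is_mspan)
qed

lemma multispaces_iff: "W \<in> multispaces \<longleftrightarrow> (\<exists>V e. vec.subspace V \<and> W = uniform_mset V e)"
  by (simp add: multispaces_def multispaces_of_rank_def multispace_iff)

section \<open>The cover relation on pairs\<close>

lemma mcovers_uniform_mset_iff:
  fixes U V :: "('a::{field,finite} ^ 'n::finite) set"
  assumes U: "vec.subspace U" and V: "vec.subspace V"
  shows "mcovers (uniform_mset U e) (uniform_mset V f) \<longleftrightarrow>
    U = V \<and> e = Suc f \<or> e = f \<and> V \<subseteq> U \<and> vec.dim U = Suc (vec.dim V)" (is "?L \<longleftrightarrow> ?R")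
proof
  assume L: ?L
  then have lt: "V \<subseteq> U" "f \<le> e" "V \<noteq> U \<or> f \<noteq> e"
    by (auto simp: mcovers_def uniform_mset_subset_iff U V)
  \<comment> \<open>The absence of intermediate multispaces, restated for pairs
    \<open>(S, g)\<close> so that suitable candidates can be tested.\<close>
  have nb: "\<not> (V \<subseteq> S \<and> f \<le> g \<and> (V \<noteq> S \<or> f \<noteq> g) \<and> S \<subseteq> U \<and> g \<le> e \<and> (S \<noteq> U \<or> g \<noteq> e))"
    if "vec.subspace S" for S g
  proof -
    have "uniform_mset S g \<in> multispaces" using that by (auto simp: multispaces_iff)
    then have "\<not> (uniform_mset V f \<subset># uniform_mset S g \<and> uniform_mset S g \<subset># uniform_mset U e)"
      using L unfolding mcovers_def by blast
    then show ?thesis using that U V by (simp add: uniform_mset_subset_iff)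
  qed
  show ?R
  proof (cases "V = U")
    case True
    then show ?thesis using lt nb[OF U, of "Suc f"] by auto
  next
    case False
    \<comment> \<open>Otherwise \<open>(V, e)\<close> would lie strictly between: subspace and
      exponent cannot both change in a cover.\<close>
    have "f = e" using nb[OF V, of e] lt False by auto
    obtain x where x: "x \<in> U" "x \<notin> V" using lt False by blast
    \<comment> \<open>The smallest subspace containing \<open>V\<close> and \<open>x\<close> is
      strictly above \<open>V\<close>, so it has to be all of \<open>U\<close>.\<close>
    let ?S = "vec.span (insert x V)"
    have "?S \<subseteq> U" using x lt U by (intro vec.span_minimal) auto
    moreover have "V \<subseteq> ?S" "x \<in> ?S" using vec.span_superset[of "insert x V"] by auto
    ultimately have "?S = U" using nb[of ?S e] x \<open>f = e\<close> by auto
    then show ?thesis using dim_span_insert_subspace[OF V x(2)] \<open>f = e\<close> lt by auto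
  qed
next
  assume R: ?R
  have dim_eq: "S = T" if "vec.subspace S" "vec.subspace T" "S \<subseteq> T" "vec.dim T \<le> vec.dim S"
    for S T :: "('a ^ 'n) set"
    using that vec.subspace_dim_equal by blast
  have "\<not> (\<exists>z \<in> multispaces. uniform_mset V f \<subset># z \<and> z \<subset># uniform_mset U e)"
  proof
    assume "\<exists>z \<in> multispaces. uniform_mset V f \<subset># z \<and> z \<subset># uniform_mset U e"
    then obtain S g where S: "vec.subspace S"
      and lt: "uniform_mset V f \<subset># uniform_mset S g" "uniform_mset S g \<subset># uniform_mset U e"
      by (auto simp: multispaces_iff)
    have *: "V \<subseteq> S" "f \<le> g" "V \<noteq> S \<or> f \<noteq> g" "S \<subseteq> U" "g \<le> e" "S \<noteq> U \<or> g \<noteq> e"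
      using lt unfolding uniform_mset_subset_iff[OF V S] uniform_mset_subset_iff[OF S U] by blast+
    show False
    proof (cases "U = V")
      case True
      then have "e = Suc f" "S = V" using * R by auto
      then have "f \<noteq> g" "g \<noteq> e" using * True by auto
      then show False using * \<open>e = Suc f\<close> by linarith
    next
      case False
      then have R': "e = f" "vec.dim U = Suc (vec.dim V)" using R by auto
      then have "V \<noteq> S" "S \<noteq> U" using * by auto
      \<comment> \<open>No dimension lies strictly between two consecutive ones, so the dimension of
        \<open>S\<close> forces it to equal \<open>V\<close> or \<open>U\<close>.\<close>
      moreover have "vec.dim U \<le> vec.dim S \<or> vec.dim S \<le> vec.dim V" using R' by linarith
      ultimately show False using * dim_eq[OF V S] dim_eq[OF S U] by blast
    qed
  qed
  moreover have "uniform_mset V f \<subset># uniform_mset U e"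
    unfolding uniform_mset_subset_iff[OF V U] using R by auto
  moreover have "uniform_mset U e \<in> multispaces" "uniform_mset V f \<in> multispaces"
    using U V by (auto simp: multispaces_iff)
  ultimately show ?L unfolding mcovers_def by blast
qed

section \<open>The three counts\<close>

text \<open>Once the rank is fixed, the subspace \<open>V\<close> forces the exponent
  \<open>m - vec.dim V\<close>, so the subspaces of dimension at most \<open>m\<close> are counted,
  one dimension at a time. Dimensions above \<open>CARD('n)\<close> contribute 0 on both
  sides.\<close>

theorem card_multispaces_of_rank:
  "real (card (multispaces_of_rank m :: ('a::{field,finite} ^ 'n::finite) multiset set)) =
    (\<Sum>k=0..m. gauss_coeff CARD('a) CARD('n) k)"
proof -
  let ?A = "{V :: ('a ^ 'n) set. vec.subspace V \<and> vec.dim V \<le> m}"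
  let ?f = "\<lambda>V. uniform_mset V (m - vec.dim V)"
  have "multispaces_of_rank m = ?f ` ?A"
  proof (intro set_eqI iffI)
    fix W :: "('a ^ 'n) multiset" assume "W \<in> multispaces_of_rank m"
    then obtain V e where "vec.subspace V" "W = uniform_mset V e" "m = vec.dim V + e"
      by (auto simp: multispaces_of_rank_def multispace_iff mrank_uniform_mset)
    then show "W \<in> ?f ` ?A" by (intro image_eqI[of _ _ V]) auto
  qed (auto simp: multispaces_of_rank_def multispace_iff mrank_uniform_mset)
  moreover have "inj_on ?f ?A" by (rule inj_onI) (simp add: uniform_mset_eq_iff)
  ultimately have "card (multispaces_of_rank m :: ('a ^ 'n) multiset set) = card ?A"
    by (simp add: card_image)
  also have "?A = (\<Union>k\<in>{0..m}. subspaces_within UNIV k)" by (auto simp: subspaces_within_def)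
  also have "card \<dots> = (\<Sum>k=0..m. card (subspaces_within (UNIV :: ('a ^ 'n) set) k))"
    by (rule card_UN_disjoint) (auto simp: subspaces_within_def)
  finally show ?thesis
    by (simp add: card_subspaces_within vec_dim_card del: vec.dim_UNIV)
qed

text \<open>Going down, either \<open>U\<close> shrinks to one of its hyperplanes or the exponent
  drops by one, which requires \<open>e > 0\<close>.\<close>

theorem card_covered:
  fixes U :: "('a::{field,finite} ^ 'n::finite) set"
  assumes U: "vec.subspace U"
  shows "card {X. mcovers (uniform_mset U e) X} =
    (if e = 0 then 0 else 1) + (\<Sum>i<vec.dim U. CARD('a) ^ i)"
proof -
  let ?A = "{S. vec.subspace S \<and> S \<subseteq> U \<and> vec.dim U = Suc (vec.dim S)}"
  let ?f = "\<lambda>S. uniform_mset S e"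
  \<comment> \<open>The case \<open>e = 0\<close> is separated because \<open>e - 1\<close> would
    then be 0 and give back the multispace itself.\<close>
  let ?E = "if e = 0 then {} else {uniform_mset U (e - 1)}"
  have "X \<in> multispaces" if "mcovers (uniform_mset U e) X" for X using that by (simp add: mcovers_def)
  then have "{X. mcovers (uniform_mset U e) X} = ?E \<union> ?f ` ?A"
    using U by (cases e) (fastforce simp: multispaces_iff mcovers_uniform_mset_iff)+
  moreover have "?E \<inter> ?f ` ?A = {}" using U by (auto simp: uniform_mset_eq_iff)
  moreover have "card (?f ` ?A) = card ?A"
    by (intro card_image inj_onI) (simp add: uniform_mset_eq_iff)
  ultimately show ?thesis
    by (simp add: card_Un_disjoint card_hyperplanes[OF U] del: Int_insert_left)
qed

text \<open>Going up, the exponent can always be raised, which accounts for the summand 1; the other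
  covers enlarge \<open>V\<close> by one dimension.\<close>

theorem card_covering:
  fixes V :: "('a::{field,finite} ^ 'n::finite) set"
  assumes V: "vec.subspace V"
  shows "card {X. mcovers X (uniform_mset V e)} = 1 + (\<Sum>i<CARD('n) - vec.dim V. CARD('a) ^ i)"
proof -
  let ?A = "{S. vec.subspace S \<and> V \<subseteq> S \<and> vec.dim S = Suc (vec.dim V)}"
  let ?f = "\<lambda>S. uniform_mset S e"
  have "X \<in> multispaces" if "mcovers X (uniform_mset V e)" for X using that by (simp add: mcovers_def)
  then have "{X. mcovers X (uniform_mset V e)} = insert (uniform_mset V (Suc e)) (?f ` ?A)"
    using V by (fastforce simp: multispaces_iff mcovers_uniform_mset_iff)
  moreover have "uniform_mset V (Suc e) \<notin> ?f ` ?A" using V by (auto simp: uniform_mset_eq_iff)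
  moreover have "card (?f ` ?A) = card ?A"
    by (intro card_image inj_onI) (simp add: uniform_mset_eq_iff)
  ultimately show ?thesis by (simp add: card_upper_hyperplanes[OF V])
qed

theorem proposition2p7:
  fixes q n :: nat
  assumes "q = CARD('a::{field,finite})" and "n = CARD('n::finite)"
  shows
    "(\<forall>m. real (card (multispaces_of_rank m :: ('a ^ 'n) multiset set)) =
          (\<Sum>k=0..m. gauss_coeff q n k))
   \<and> (\<forall>W :: ('a ^ 'n) multiset. W \<in> multispaces \<and> mrank W \<ge> 1 \<longrightarrow>
          card {V. mcovers W V} =
            (if mrank W = mdim W then (\<Sum>i<mdim W. q ^ i)
             else 1 + (\<Sum>i<mdim W. q ^ i)))
   \<and> (\<forall>W :: ('a ^ 'n) multiset. W \<in> multispaces \<longrightarrow>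
          card {V. mcovers V W} = 1 + (\<Sum>i<n - mdim W. q ^ i))"
  \<comment> \<open>With \<open>W\<close> written as \<open>uniform_mset V e\<close>, the rank is
    \<open>vec.dim V + e\<close> and the dimension is \<open>vec.dim V\<close>, so the case
    distinction on \<open>mrank W = mdim W\<close> becomes the one on \<open>e = 0\<close>.\<close>
  unfolding assms
  by (auto simp: card_multispaces_of_rank multispaces_iff card_covered card_covering
      mrank_uniform_mset mdim_uniform_mset)

end
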